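(* Let $n\ge 0$ and $t\ge 0$ be integers and let $P$ be a graded poset of rank $n+1$, with dual poset $P^*$. Then $$\mu(\operatorname{Rees}(P,T_{t,n+1}))=\mu(\operatorname{Rees}(P^*,T_{t,n+1})).$$ In particular, for the chain $C_{n+1}$ on $n+1$ elements, $$\mu(\operatorname{Rees}(P,C_{n+1}))=\mu(\operatorname{Rees}(P^*,C_{n+1})).$$
   Context: All posets are finite. A graded poset $P$ has a unique minimal element $\hat 0$ and a unique maximal element $\hat 1$, all of its maximal chains have the same length, and its rank function $\rho$ satisfies $\rho(\hat 0)=0$; the rank of $P$ is $\rho(\hat 1)$. $\mu(P)$ denotes the Möbius function value $\mu_P(\hat 0,\hat 1)$. Rees product: for posets $P,Q$ with rank functions $\rho$ (minimal elements having rank $0$), $P*Q$ is the set of pairs $(p,q)\in P\times Q$ with $\rho(p)\ge\rho(q)$, ordered by $(p,q)\le(p',q')$ iff $p\le_P p'$, $q\le_Q q'$ and $\rho(p')-\rho(p)\ge\rho(q')-\rho(q)$. For $P$ graded, $\operatorname{Rees}(P,Q)=((P-\{\hat 0\})*Q)\cup\{\hat 0,\hat 1\}$, where a new minimum $\hat 0$ and a new maximum $\hat 1$ are adjoined, and where in $P-\{\hat 0\}$ the atoms of $P$ have rank $0$. $T_{t,n+1}$ is the poset of a $t$-ary tree of rank $n$: it has $t^k$ elements of rank $k$ for $0\le k\le n$, and each nonleaf element is covered by exactly $t$ children (the root is the minimum). In particular $T_{1,n+1}=C_{n+1}$. *)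

theory Defs
  imports Main "HOL-Library.Sublist"
begin

text \<open>
  A poset is encoded by its reflexive order relation \<open>r\<close>; its underlying set is \<^term>\<open>Field r\<close>,
  and the dual poset is \<open>r\<inverse>\<close>.
\<close>

definition finite_poset :: "'a rel \<Rightarrow> bool" where
  "finite_poset r \<longleftrightarrow> finite (Field r) \<and> Partial_order r"

definition minimal_in :: "'a rel \<Rightarrow> 'a \<Rightarrow> bool" where
  "minimal_in r x \<longleftrightarrow> x \<in> Field r \<and> (\<forall>y. (y, x) \<in> r \<longrightarrow> y = x)"

definition maximal_in :: "'a rel \<Rightarrow> 'a \<Rightarrow> bool" where
  "maximal_in r x \<longleftrightarrow> x \<in> Field r \<and> (\<forall>y. (x, y) \<in> r \<longrightarrow> y = x)"

definition poset_bot :: "'a rel \<Rightarrow> 'a" where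
  "poset_bot r = (THE x. minimal_in r x)"

definition poset_top :: "'a rel \<Rightarrow> 'a" where
  "poset_top r = (THE x. maximal_in r x)"

definition maximal_chain :: "'a rel \<Rightarrow> 'a set \<Rightarrow> bool" where
  "maximal_chain r C \<longleftrightarrow> C \<in> Chains r \<and> (\<forall>D\<in>Chains r. C \<subseteq> D \<longrightarrow> D = C)"

definition graded :: "'a rel \<Rightarrow> bool" where
  "graded r \<longleftrightarrow> finite_poset r \<and>
     (\<exists>!x. minimal_in r x) \<and> (\<exists>!x. maximal_in r x) \<and>
     (\<forall>C D. maximal_chain r C \<longrightarrow> maximal_chain r D \<longrightarrow> card C = card D)"

text \<open>
  The rank of \<open>x\<close> is the length (number of elements minus one) of a longest chain of elements
  below \<open>x\<close>, so minimal elements have rank 0. This also covers the posets that occur below but do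
  not have both a least and a greatest element.
\<close>

definition rk :: "'a rel \<Rightarrow> 'a \<Rightarrow> nat" where
  "rk r x = Max {card C - 1 | C. C \<in> Chains r \<and> C \<subseteq> under r x}"

definition poset_rank :: "'a rel \<Rightarrow> nat" where
  "poset_rank r = rk r (poset_top r)"

text \<open>The Moebius function; the test for a finite poset only serves to make the recursion terminate.\<close>

function moebius :: "'a rel \<Rightarrow> 'a \<Rightarrow> 'a \<Rightarrow> int" where
  "moebius r x z =
     (if finite_poset r \<and> (x, z) \<in> r then
        if x = z then 1
        else - (\<Sum>y\<in>{y. (x, y) \<in> r \<and> (y, z) \<in> r \<and> y \<noteq> z}. moebius r x y)
      else 0)"
  by pat_completeness auto
termination
proof (relation "measure (\<lambda>(r, x, z). card (under r z))")
  fix r :: "'a rel" and x z y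
  assume r: "finite_poset r \<and> (x, z) \<in> r" and y: "y \<in> {y. (x, y) \<in> r \<and> (y, z) \<in> r \<and> y \<noteq> z}"
  have po: "antisym r" "trans r" "Refl r" and fin: "finite (Field r)"
    using r by (auto simp: finite_poset_def partial_order_on_def preorder_on_def)
  have "under r z \<subseteq> Field r"
    by (auto simp: under_def Field_def)
  hence "finite (under r z)" using fin finite_subset by blast
  moreover have "under r y \<subset> under r z"
  proof
    show "under r y \<subseteq> under r z"
      using y po(2) by (auto simp: under_def dest: transD)
    have "(z, z) \<in> r" using r po(3) by (auto simp: refl_on_def Field_def)
    moreover have "(z, y) \<notin> r" using y po(1) by (auto dest: antisymD)
    ultimately show "under r y \<noteq> under r z" by (auto simp: under_def)
  qed
  ultimately show "((r, x, y), (r, x, z)) \<in> measure (\<lambda>(r, x, z). card (under r z))"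
    by (simp add: psubset_card_mono)
qed simp

declare moebius.simps [simp del]

definition moebius_number :: "'a rel \<Rightarrow> int" where
  "moebius_number r = moebius r (poset_bot r) (poset_top r)"

definition rees_product :: "'a rel \<Rightarrow> 'b rel \<Rightarrow> ('a \<times> 'b) rel" where
  "rees_product r s =
     {((p, q), (p', q')).
        (p, p') \<in> r \<and> (q, q') \<in> s \<and> rk s q \<le> rk r p \<and> rk s q' \<le> rk r p' \<and>
        int (rk s q') - int (rk s q) \<le> int (rk r p') - int (rk r p)}"

datatype 'a adjoined = Zero | Elem 'a | One

definition adjoin :: "'a rel \<Rightarrow> 'a adjoined rel" where
  "adjoin r = {(u, v). u \<in> {Zero, One} \<union> Elem ` Field r \<and> v \<in> {Zero, One} \<union> Elem ` Field r \<and>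
     (u = Zero \<or> v = One \<or> (\<exists>x y. u = Elem x \<and> v = Elem y \<and> (x, y) \<in> r))}"

definition rees :: "'a rel \<Rightarrow> 'b rel \<Rightarrow> ('a \<times> 'b) adjoined rel" where
  "rees r s = adjoin (rees_product (Restr r (Field r - {poset_bot r})) s)"

text \<open>
  The \<open>t\<close>-ary tree with ranks \<open>0, \<dots>, m - 1\<close>: a node is the list of choices (each one of \<open>t\<close>)
  leading to it from the root \<open>[]\<close>, so that there are \<open>t ^ k\<close> nodes of rank \<open>k\<close>. For \<open>t = 0\<close> only
  the root remains.
\<close>

definition tree_poset :: "nat \<Rightarrow> nat \<Rightarrow> nat list rel" where
  "tree_poset t m = {(u, v). prefix u v \<and> set v \<subseteq> {..<t} \<and> length v < m}"

definition chain_poset :: "nat \<Rightarrow> nat rel" where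
  "chain_poset m = {(i, j). i \<le> j \<and> j < m}"

text \<open>
  The Rees product is a finite poset (so \<^const>\<open>moebius\<close> is applied to it in its intended range)
  whose bottom and top are the adjoined elements, and the tree has the expected ranks.
\<close>

lemma finite_poset_alt:
  "finite_poset r \<longleftrightarrow> finite (Field r) \<and> Refl r \<and> trans r \<and> antisym r"
  by (auto simp: finite_poset_def partial_order_on_def preorder_on_def Field_def)

lemma finite_poset_adjoin: assumes r: "finite_poset r" shows "finite_poset (adjoin r)"
proof -
  have F: "Field (adjoin r) = {Zero, One} \<union> Elem ` Field r"
    by (auto simp: adjoin_def Field_def)
  have refl: "Refl (adjoin r)"
    using r unfolding refl_on_def F by (auto simp: adjoin_def finite_poset_alt refl_on_def)
  have tr: "trans (adjoin r)"
    using r unfolding finite_poset_alt by (intro transI) (auto simp: adjoin_def dest: transD)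
  have anti: "antisym (adjoin r)"
    using r unfolding finite_poset_alt by (intro antisymI) (auto simp: adjoin_def dest: antisymD)
  show ?thesis using r refl tr anti F by (simp add: finite_poset_alt)
qed

lemma minimal_in_adjoin: "minimal_in (adjoin r) u \<longleftrightarrow> u = Zero"
  by (auto simp: minimal_in_def adjoin_def Field_def)

lemma maximal_in_adjoin: "maximal_in (adjoin r) u \<longleftrightarrow> u = One"
  by (auto simp: maximal_in_def adjoin_def Field_def)

lemma finite_poset_rees_product:
  assumes "finite_poset r" "finite_poset s" shows "finite_poset (rees_product r s)"
proof -
  have "Field (rees_product r s) \<subseteq> Field r \<times> Field s"
    by (auto simp: rees_product_def Field_def)
  hence "finite (Field (rees_product r s))"
    using assms by (meson finite_SigmaI finite_subset finite_poset_def)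
  moreover have "antisym (rees_product r s)"
    using assms unfolding finite_poset_alt
    by (intro antisymI) (auto simp: rees_product_def dest: antisymD)
  moreover have "trans (rees_product r s)"
    using assms unfolding finite_poset_alt
    by (intro transI) (auto simp: rees_product_def dest: transD)
  moreover have "Refl (rees_product r s)"
    using assms unfolding finite_poset_alt
    by (auto simp: rees_product_def refl_on_def Field_def)
  ultimately show ?thesis by (simp add: finite_poset_alt)
qed

lemma finite_poset_Restr: "finite_poset r \<Longrightarrow> finite_poset (Restr r A)"
proof -
  assume r: "finite_poset r"
  have "Field (Restr r A) \<subseteq> Field r" by (auto simp: Field_def)
  hence "finite (Field (Restr r A))" using r by (meson finite_poset_alt finite_subset)
  moreover have "Refl (Restr r A)"
    using r by (auto simp: finite_poset_alt refl_on_def Field_def)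
  moreover have "trans (Restr r A)" "antisym (Restr r A)"
    using r by (auto simp: finite_poset_alt intro: trans_Restr antisym_Restr)
  ultimately show ?thesis by (simp add: finite_poset_alt)
qed

lemma finite_poset_rees: "finite_poset r \<Longrightarrow> finite_poset s \<Longrightarrow> finite_poset (rees r s)"
  by (simp add: rees_def finite_poset_adjoin finite_poset_rees_product finite_poset_Restr)

lemma poset_bot_rees: "poset_bot (rees r s) = Zero"
  by (simp add: poset_bot_def rees_def minimal_in_adjoin)

lemma poset_top_rees: "poset_top (rees r s) = One"
  by (simp add: poset_top_def rees_def maximal_in_adjoin)

lemma finite_rk_set: "finite_poset r \<Longrightarrow> finite {card C - 1 | C. C \<in> Chains r \<and> C \<subseteq> under r x}"
proof -
  assume "finite_poset r"
  hence "finite {C. C \<subseteq> Field r}" by (simp add: finite_poset_def)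
  moreover have "{card C - 1 | C. C \<in> Chains r \<and> C \<subseteq> under r x} \<subseteq> (\<lambda>C. card C - 1) ` {C. C \<subseteq> Field r}"
    by (auto simp: under_def Field_def)
  ultimately show ?thesis by (meson finite_imageI finite_subset)
qed

lemma finite_poset_chain: "finite_poset (chain_poset m)"
proof -
  have "Field (chain_poset m) = {..<m}" by (auto simp: chain_poset_def Field_def)
  thus ?thesis by (auto simp: finite_poset_alt refl_on_def chain_poset_def antisym_def trans_def)
qed

lemma Field_tree: "Field (tree_poset t m) = {v. set v \<subseteq> {..<t} \<and> length v < m}"
  by (auto simp: tree_poset_def Field_def prefix_def)

lemma finite_poset_tree: "finite_poset (tree_poset t m)"
proof -
  have "finite (Field (tree_poset t m))" unfolding Field_tree
    by (rule finite_subset[OF _ finite_lists_length_le[of "{..<t}" m]]) auto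
  thus ?thesis unfolding finite_poset_alt Field_tree
    by (auto simp: refl_on_def tree_poset_def antisym_def trans_def)
qed

lemma rk_tree: assumes v: "v \<in> Field (tree_poset t m)" shows "rk (tree_poset t m) v = length v"
  unfolding rk_def
proof (rule Max_eqI)
  show "finite {card C - 1 |C. C \<in> Chains (tree_poset t m) \<and> C \<subseteq> under (tree_poset t m) v}"
    by (rule finite_rk_set[OF finite_poset_tree])
next
  fix k assume "k \<in> {card C - 1 |C. C \<in> Chains (tree_poset t m) \<and> C \<subseteq> under (tree_poset t m) v}"
  then obtain C where k: "k = card C - 1" and C: "C \<subseteq> under (tree_poset t m) v" by auto
  have "C \<subseteq> (\<lambda>i. take i v) ` {..length v}"
  proof
    fix u assume "u \<in> C"
    hence "prefix u v" using C by (auto simp: under_def tree_poset_def)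
    hence "u = take (length u) v" "length u \<le> length v" by (auto simp: prefix_def)
    thus "u \<in> (\<lambda>i. take i v) ` {..length v}" by blast
  qed
  hence "card C \<le> Suc (length v)" by (metis card_atMost finite_atMost surj_card_le)
  thus "k \<le> length v" using k by simp
next
  let ?C = "(\<lambda>i. take i v) ` {..length v}"
  have vv: "set v \<subseteq> {..<t}" "length v < m" using v by (auto simp: Field_tree)
  have "inj_on (\<lambda>i. take i v) {..length v}"
    by (rule inj_onI) (metis atMost_iff length_take min.absorb2)
  hence "card ?C = Suc (length v)" by (simp add: card_image)
  moreover have "?C \<in> Chains (tree_poset t m)" 
  proof -
    have "\<And>i j. prefix (take i v) (take j v) \<or> prefix (take j v) (take i v)"
      by (meson prefix_same_cases take_is_prefix)
    moreover have "\<And>i. set (take i v) \<subseteq> {..<t}" using vv by (meson set_take_subset subset_trans)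
    ultimately show ?thesis using vv by (auto simp: Chains_def tree_poset_def min_def take_is_prefix)
  qed
  moreover have "?C \<subseteq> under (tree_poset t m) v"
    using vv by (auto simp: under_def tree_poset_def take_is_prefix)
  ultimately show "length v \<in> {card C - 1 |C. C \<in> Chains (tree_poset t m) \<and> C \<subseteq> under (tree_poset t m) v}"
    by (smt (verit) diff_Suc_1 mem_Collect_eq)
qed

lemma card_tree_level: "k < m \<Longrightarrow> card {v \<in> Field (tree_poset t m). rk (tree_poset t m) v = k} = t ^ k"
proof -
  assume "k < m"
  hence "{v \<in> Field (tree_poset t m). rk (tree_poset t m) v = k} = {v. set v \<subseteq> {..<t} \<and> length v = k}"
    using rk_tree by (fastforce simp: Field_tree)
  thus ?thesis by (simp add: card_lists_length_eq)
qed

end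

theory Submission
  imports Defs
begin

text \<open>
  Write \<open>\<rho>\<close> for the rank function of \<open>P\<close>, \<open>N = n + 1\<close> for its rank, \<open>0\<close> and \<open>1\<close> for its least and
  greatest element, and \<open>[k] = 1 + t + \<dots> + t ^ (k - 1)\<close>. The invariant is expressed through a
  weight on \<open>P\<close> alone. Let \<open>G x\<close>, for \<open>x \<noteq> 0\<close>, be the sum of the Moebius values of
  \<open>Rees(P, T)\<close> from its minimum to \<open>(x, q)\<close> over all admissible \<open>q\<close>, and let \<open>G 0 = 1\<close>. Then the
  Moebius number of \<open>Rees(P, T)\<close> is \<open>- (\<Sum>x. G x)\<close>. Summing the Moebius recursion at \<open>(y, q)\<close> over all
  \<open>q\<close>, a given pair \<open>(x, q')\<close> is counted once for every descendant of \<open>q'\<close> at most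
  \<open>\<rho> y - \<rho> x\<close> levels above it, that is \<open>[\<rho> y - \<rho> x + 1]\<close> times, and this gives

    \<open>(\<Sum>x\<le>y. G x * [\<rho> y - \<rho> x + 1]) = t ^ \<rho> y\<close>   for all \<open>y\<close>.

  What enters about the tree is that it has a root and that each node has \<open>t ^ k\<close> descendants \<open>k\<close>
  levels up; the chain has the same property with \<open>t = 1\<close>. All this is \<open>moebius_number_rees\<close>.

  In the dual poset \<open>x\<close> has rank \<open>N - \<rho> x\<close>, so the weight \<open>H\<close> that belongs to the dual satisfies the
  transposed system

    \<open>(\<Sum>y\<ge>x. [\<rho> y - \<rho> x + 1] * H y) = t ^ (N - \<rho> x)\<close>   for all \<open>x\<close>.

  It remains to see that \<open>G\<close> and \<open>H\<close> have the same total. Evaluating the bilinear sum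
  \<open>D = (\<Sum>x\<le>y. G x * [\<rho> y - \<rho> x + 1] * H y)\<close> with either system gives
  \<open>D = (\<Sum>x. G x * t ^ (N - \<rho> x)) = (\<Sum>y. t ^ \<rho> y * H y)\<close>. The identity
  \<open>1 = (1 - t) * [d + 1] + t * t ^ d\<close>, with \<open>d = N - \<rho> x\<close>, and the system for \<open>G\<close> at the greatest element
  yield \<open>(\<Sum>x. G x) = (1 - t) * t ^ N + t * D\<close>. With \<open>d = \<rho> y\<close> and the system for \<open>H\<close> at the least
  element, \<open>(\<Sum>y. H y)\<close> has the same value. This is \<open>moebius_number_rees_dual\<close>.
\<close>

section \<open>Ranks in finite graded posets\<close>

lemma Chains_converse: "Chains (r\<inverse>) = Chains r"
  by (simp add: Chains_def disj_commute)

lemma minimal_in_converse: "minimal_in (r\<inverse>) x = maximal_in r x"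
  by (simp add: minimal_in_def maximal_in_def)

lemma maximal_in_converse: "maximal_in (r\<inverse>) x = minimal_in r x"
  by (simp add: minimal_in_def maximal_in_def)

lemma finite_poset_converse: "finite_poset r \<Longrightarrow> finite_poset (r\<inverse>)"
  by (auto simp: finite_poset_alt refl_on_def)

lemma maximal_chain_converse: "maximal_chain (r\<inverse>) C = maximal_chain r C"
  by (simp only: maximal_chain_def Chains_converse)

lemma graded_converse: "graded r \<Longrightarrow> graded (r\<inverse>)"
  unfolding graded_def maximal_chain_converse minimal_in_converse maximal_in_converse
  by (intro conjI finite_poset_converse; elim conjE; assumption)

lemma poset_bot_converse: "poset_bot (r\<inverse>) = poset_top r"
  by (simp add: poset_bot_def poset_top_def minimal_in_converse)

lemma finite_under: "finite_poset r \<Longrightarrow> finite (under r x)"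
  unfolding finite_poset_def by (meson finite_subset under_Field)

lemma finite_chain_under:
  "finite_poset r \<Longrightarrow> C \<subseteq> under r x \<Longrightarrow> finite C"
  by (rule finite_subset[OF _ finite_under])

lemma minimal_below:
  assumes "finite_poset r" "x \<in> Field r"
  shows "\<exists>y. minimal_in r y \<and> (y, x) \<in> r"
proof -
  have r: "trans r" "antisym r" "Refl r" using assms by (auto simp: finite_poset_alt)
  have xx: "(x, x) \<in> r" using r assms by (auto simp: refl_on_def)
  \<comment> \<open>An element with the fewest elements below it is minimal, since \<open>under\<close> is strictly monotone.\<close>
  define y where "y = arg_min (\<lambda>y. card (under r y)) (\<lambda>y. (y, x) \<in> r)"
  have y: "(y, x) \<in> r" unfolding y_def by (rule arg_min_natI[of _ x]) (rule xx)
  have min: "card (under r y) \<le> card (under r z)" if "(z, x) \<in> r" for z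
    unfolding y_def by (rule arg_min_nat_le) (rule that)
  have "z = y" if z: "(z, y) \<in> r" for z
  proof (rule ccontr)
    assume "z \<noteq> y"
    have "under r z \<subseteq> under r y" using z r by (auto simp: under_def dest: transD)
    moreover have "y \<in> under r y" using y r by (auto simp: under_def refl_on_def Field_def)
    moreover have "y \<notin> under r z" using z r \<open>z \<noteq> y\<close> by (auto simp: under_def dest: antisymD)
    ultimately have "card (under r z) < card (under r y)"
      by (intro psubset_card_mono) (use finite_under assms in auto)
    moreover have "(z, x) \<in> r" using z y r by (auto dest: transD)
    ultimately show False using min[of z] by simp
  qed
  thus ?thesis using y by (auto simp: minimal_in_def Field_def)
qed

lemma graded_bot:
  assumes "graded r"
  shows "minimal_in r (poset_bot r)" "x \<in> Field r \<Longrightarrow> (poset_bot r, x) \<in> r"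
proof -
  have ex: "\<exists>!x. minimal_in r x" and fp: "finite_poset r" using assms by (auto simp: graded_def)
  show m: "minimal_in r (poset_bot r)" unfolding poset_bot_def by (rule theI'[OF ex])
  show "x \<in> Field r \<Longrightarrow> (poset_bot r, x) \<in> r"
    using minimal_below[OF fp] m ex by blast
qed

lemma graded_top:
  assumes "graded r"
  shows "maximal_in r (poset_top r)" "x \<in> Field r \<Longrightarrow> (x, poset_top r) \<in> r"
  using graded_bot[OF graded_converse[OF assms]]
  by (simp_all add: poset_bot_converse minimal_in_converse)

lemma rk_ge_chain:
  assumes "finite_poset r" "C \<in> Chains r" "C \<subseteq> under r x"
  shows "card C \<le> rk r x + 1"
proof -
  have "card C - 1 \<le> rk r x" unfolding rk_def
    by (rule Max_ge[OF finite_rk_set[OF assms(1)]]) (use assms in blast)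
  thus ?thesis by simp
qed

lemma insert_upper_bound_Chains:
  assumes "finite_poset r" "x \<in> Field r" "C \<in> Chains r" "C \<subseteq> under r x"
  shows "insert x C \<in> Chains r"
  using assms by (auto simp: Chains_def under_def finite_poset_alt refl_on_def)

text \<open>
  A longest chain below \<open>x\<close> may be taken to contain \<open>x\<close>: adding \<open>x\<close> gives a chain again, and it
  cannot get longer. Having \<open>x\<close> in it allows chains from below and from above to be glued.
\<close>

lemma rk_chain:
  assumes "finite_poset r" "x \<in> Field r"
  obtains C where "C \<in> Chains r" "C \<subseteq> under r x" "x \<in> C" "card C = rk r x + 1"
proof -
  have "{} \<in> Chains r" by (simp add: Chains_def)
  hence "rk r x \<in> {card C - 1 | C. C \<in> Chains r \<and> C \<subseteq> under r x}"
    unfolding rk_def by (intro Max_in finite_rk_set assms(1)) blast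
  then obtain C where C: "C \<in> Chains r" "C \<subseteq> under r x" "rk r x = card C - 1" by blast
  let ?C = "insert x C"
  have ch: "?C \<in> Chains r" using insert_upper_bound_Chains assms C by metis
  have un: "?C \<subseteq> under r x" using C assms by (auto simp: under_def finite_poset_alt refl_on_def)
  have fin: "finite C" using finite_chain_under assms(1) C(2) by metis
  have "card ?C \<le> rk r x + 1" using rk_ge_chain[OF assms(1) ch un] .
  moreover have "card C \<le> card ?C" "card ?C > 0"
    using fin by (simp_all add: card_insert_le card_gt_0_iff)
  hence "rk r x + 1 \<le> card ?C" using C(3) by simp
  ultimately have card: "card ?C = rk r x + 1" by simp
  show ?thesis by (rule that[OF ch un _ card]) simp
qed

lemma rk_mono:
  assumes "finite_poset r" "(x, y) \<in> r"
  shows "rk r x \<le> rk r y"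
proof -
  have "x \<in> Field r" using assms by (auto simp: Field_def)
  then obtain C where C: "C \<in> Chains r" "C \<subseteq> under r x" "card C = rk r x + 1"
    by (rule rk_chain[OF assms(1)]) blast
  moreover have "under r x \<subseteq> under r y"
    using assms by (auto simp: under_def finite_poset_alt dest: transD)
  ultimately show ?thesis using rk_ge_chain[OF assms(1), of C y] by auto
qed

lemma rk_minimal: 
  assumes "finite_poset r" "minimal_in r x"
  shows "rk r x = 0"
proof -
  have x: "x \<in> Field r" and "under r x \<subseteq> {x}"
    using assms by (auto simp: minimal_in_def under_def)
  moreover obtain C where C: "C \<subseteq> under r x" "card C = rk r x + 1"
    by (rule rk_chain[OF assms(1) x]) blast
  ultimately have "card C \<le> card {x}" by (intro card_mono) auto
  thus ?thesis using C by simp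
qed

text \<open>
  A longest chain below \<open>x\<close> and a longest chain above \<open>x\<close> meet in \<open>x\<close> only, and their union is a
  maximal chain: any chain that contains \<open>x\<close> is cut by \<open>x\<close> into a lower and an upper part, neither of
  which can be longer.
\<close>

lemma rk_plus_dual_rk_maximal_chain:
  assumes fp: "finite_poset r" and x: "x \<in> Field r"
  obtains C where "maximal_chain r C" "card C = rk r x + rk (r\<inverse>) x + 1"
proof -
  have fp': "finite_poset (r\<inverse>)" and x': "x \<in> Field (r\<inverse>)"
    using fp x by (simp_all add: finite_poset_converse)
  have tr: "trans r" and anti: "antisym r" using fp by (auto simp: finite_poset_alt)
  obtain C where C: "C \<in> Chains r" "C \<subseteq> under r x" "x \<in> C" "card C = rk r x + 1"
    by (rule rk_chain[OF fp x]) blast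
  obtain D where D: "D \<in> Chains (r\<inverse>)" "D \<subseteq> under (r\<inverse>) x" "x \<in> D" "card D = rk (r\<inverse>) x + 1"
    by (rule rk_chain[OF fp' x']) blast
  have split: "card E \<le> rk r x + rk (r\<inverse>) x + 1" if E: "E \<in> Chains r" "C \<union> D \<subseteq> E" for E
  proof -
    let ?A = "E \<inter> under r x" and ?B = "E \<inter> under (r\<inverse>) x"
    have xE: "x \<in> E" using C(3) E by blast
    have "E = ?A \<union> ?B" using E xE by (auto simp: Chains_def under_def)
    moreover have "?A \<inter> ?B = {x}"
      using xE E anti by (auto simp: Chains_def under_def dest: antisymD)
    moreover have "finite ?A" "finite ?B"
      by (simp_all add: finite_under fp fp')
    ultimately have "card E + 1 = card ?A + card ?B"
      by (metis card_Un_Int card.empty card_insert_disjoint empty_iff finite.emptyI One_nat_def)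
    moreover have "card ?A \<le> rk r x + 1"
      by (rule rk_ge_chain[OF fp]) (use E in \<open>auto simp: Chains_def\<close>)
    moreover have "card ?B \<le> rk (r\<inverse>) x + 1"
      by (rule rk_ge_chain[OF fp']) (use E in \<open>auto simp: Chains_def\<close>)
    ultimately show ?thesis by simp
  qed
  have "(c, x) \<in> r" if "c \<in> C" for c using C(2) that by (auto simp: under_def)
  moreover have "(x, d) \<in> r" if "d \<in> D" for d using D(2) that by (auto simp: under_def)
  ultimately have "(c, d) \<in> r" if "c \<in> C" "d \<in> D" for c d using that tr by (meson transD)
  moreover have "D \<in> Chains r" using D(1) by (simp add: Chains_converse)
  ultimately have CD: "C \<union> D \<in> Chains r" using C(1) unfolding Chains_def by blast
  have fin: "finite C" "finite D" using C D fp fp' finite_chain_under by metis+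
  have "C \<inter> D = {x}"
    using C D anti by (auto simp: under_def dest: antisymD)
  hence card: "card (C \<union> D) = rk r x + rk (r\<inverse>) x + 1"
    using card_Un_Int[OF fin] C(4) D(4) by simp
  have "maximal_chain r (C \<union> D)" unfolding maximal_chain_def
  proof (intro conjI ballI impI)
    fix E assume E: "E \<in> Chains r" "C \<union> D \<subseteq> E"
    have "E \<subseteq> Field r" using E by (auto simp: Chains_def Field_def)
    hence "finite E" using fp by (auto simp: finite_poset_def intro: finite_subset)
    thus "E = C \<union> D" using card_seteq[OF _ E(2)] split[OF E] card by simp
  qed (rule CD)
  thus ?thesis using card by (rule that)
qed

text \<open>
  Duality reverses the rank. All maximal chains have the same size, so the sum of the
  two ranks does not depend on \<open>x\<close>; at the greatest element it is the rank of the poset.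
\<close>

lemma rk_plus_dual_rk:
  assumes g: "graded r" and x: "x \<in> Field r"
  shows "rk r x + rk (r\<inverse>) x = poset_rank r"
proof -
  let ?T = "poset_top r"
  have fp: "finite_poset r" using g by (simp add: graded_def)
  have T: "maximal_in r ?T" by (rule graded_top[OF g])
  hence TF: "?T \<in> Field r" by (simp add: maximal_in_def)
  have "rk (r\<inverse>) ?T = 0"
    by (rule rk_minimal) (use fp T in \<open>simp_all add: finite_poset_converse minimal_in_converse\<close>)
  moreover obtain C where "maximal_chain r C" "card C = rk r x + rk (r\<inverse>) x + 1"
    by (rule rk_plus_dual_rk_maximal_chain[OF fp x])
  moreover obtain D where "maximal_chain r D" "card D = rk r ?T + rk (r\<inverse>) ?T + 1"
    by (rule rk_plus_dual_rk_maximal_chain[OF fp TF])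
  moreover have "card C = card D" using g calculation unfolding graded_def by blast
  ultimately show ?thesis by (simp add: poset_rank_def)
qed

lemma Field_delete_bot:
  assumes "graded r"
  shows "Field (Restr r (Field r - {poset_bot r})) = Field r - {poset_bot r}"
proof -
  have "Refl r" using assms by (auto simp: graded_def finite_poset_alt)
  thus ?thesis by (auto simp: Field_def refl_on_def)
qed

text \<open>
  Chains of the truncated poset below \<open>x\<close> become chains of \<open>r\<close> by adding the least element, and
  conversely by deleting it.
\<close>

lemma rk_delete_bot:
  assumes g: "graded r" and x: "x \<in> Field r" "x \<noteq> poset_bot r"
  shows "rk r x = rk (Restr r (Field r - {poset_bot r})) x + 1"
proof -
  let ?b = "poset_bot r" and ?s = "Restr r (Field r - {poset_bot r})"
  have fp: "finite_poset r" using g by (simp add: graded_def)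
  have fs: "finite_poset ?s" using finite_poset_Restr[OF fp] .
  have xs: "x \<in> Field ?s" using x by (simp add: Field_delete_bot[OF g])
  have bot: "(?b, y) \<in> r" if "y \<in> Field r" for y using graded_bot(2)[OF g that] .
  have bF: "?b \<in> Field r" using graded_bot(1)[OF g] by (simp add: minimal_in_def)
  obtain C where C: "C \<in> Chains ?s" "C \<subseteq> under ?s x" "card C = rk ?s x + 1"
    by (rule rk_chain[OF fs xs]) blast
  have "C \<subseteq> Field r - {?b}" using C by (auto simp: under_def)
  hence "insert ?b C \<in> Chains r" "?b \<notin> C"
    using C(1) bot bF by (auto simp: Chains_def)
  moreover have "insert ?b C \<subseteq> under r x" using C(2) bot x by (auto simp: under_def)
  moreover have "finite C" using finite_chain_under[OF fs C(2)] .
  ultimately have 1: "rk ?s x + 1 \<le> rk r x"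
    using rk_ge_chain[OF fp, of "insert ?b C" x] C(3) by simp
  obtain D where D: "D \<in> Chains r" "D \<subseteq> under r x" "card D = rk r x + 1"
    by (rule rk_chain[OF fp x(1)]) blast
  have "D - {?b} \<in> Chains ?s" "D - {?b} \<subseteq> under ?s x"
    using D x by (auto simp: Chains_def under_def Field_def)
  hence "card (D - {?b}) \<le> rk ?s x + 1" by (rule rk_ge_chain[OF fs])
  moreover have "card D \<le> card (D - {?b}) + 1"
    using finite_chain_under[OF fp D(2)] by (metis card_Diff_singleton_if le_add1 le_diff_conv
        order_refl)
  ultimately show ?thesis using 1 D(3) by simp
qed

section \<open>Posets that branch uniformly\<close>

text \<open>
  The common feature of the \<open>t\<close>-ary tree and (for \<open>t = 1\<close>) the chain. The condition stops
  at rank \<open>n\<close>, where the tree ends.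
\<close>

definition uniformly_branching :: "'b rel \<Rightarrow> nat \<Rightarrow> nat \<Rightarrow> bool" where
  "uniformly_branching Q t n \<longleftrightarrow> finite_poset Q \<and>
     (\<exists>q\<^sub>0\<in>Field Q. rk Q q\<^sub>0 = 0 \<and> (\<forall>q\<in>Field Q. (q\<^sub>0, q) \<in> Q)) \<and>
     (\<forall>q\<in>Field Q. \<forall>k. rk Q q + k \<le> n \<longrightarrow>
        card {q'. (q, q') \<in> Q \<and> rk Q q' = rk Q q + k} = t ^ k)"

definition q_bracket :: "nat \<Rightarrow> nat \<Rightarrow> int" where
  "q_bracket t k = (\<Sum>i<k. int t ^ i)"

text \<open>
  This writes the constant \<open>1\<close> as a combination of the two
  kernels \<open>[d + 1]\<close> and \<open>t ^ d\<close>, uniformly in \<open>t\<close> (no division by \<open>1 - t\<close>).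
\<close>

lemma q_bracket_Suc_identity:
  "(1 - int t) * q_bracket t (Suc d) + int t * int t ^ d = 1"
proof -
  have "(1 - int t) * q_bracket t (Suc d) = 1 - int t ^ Suc d"
    unfolding q_bracket_def by (rule one_diff_power_eq[symmetric])
  thus ?thesis by simp
qed

lemma q_bracket_Suc: "q_bracket t (Suc d) = q_bracket t d + int t ^ d"
  by (simp add: q_bracket_def)

lemma uniformly_branching_tree: "uniformly_branching (tree_poset t (n + 1)) t n"
proof -
  let ?T = "tree_poset t (n + 1)"
  have "card {v. (u, v) \<in> ?T \<and> rk ?T v = rk ?T u + k} = t ^ k"
    if u: "u \<in> Field ?T" and k: "rk ?T u + k \<le> n" for u k
  proof -
    have u': "set u \<subseteq> {..<t}" using u by (simp add: Field_tree)
    have k': "length u + k \<le> n" using k rk_tree[OF u] by simp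
    have "{v. (u, v) \<in> ?T \<and> rk ?T v = rk ?T u + k}
        = {v. (u, v) \<in> ?T \<and> length v = length u + k}"
      using rk_tree[OF u] rk_tree[of _ t "n + 1"] FieldI2[of u _ ?T] by (intro Collect_cong) metis
    also have "\<dots> = (@) u ` {w. set w \<subseteq> {..<t} \<and> length w = k}"
      using u' k' by (auto simp: tree_poset_def prefix_def)
    also have "card \<dots> = t ^ k"
      by (subst card_image) (auto simp: inj_on_def card_lists_length_eq)
    finally show ?thesis .
  qed
  moreover have "[] \<in> Field ?T" "rk ?T [] = 0"
    using rk_tree[of "[]" t "n + 1"] by (auto simp: Field_tree)
  moreover have "([], v) \<in> ?T" if "v \<in> Field ?T" for v
    using that unfolding Field_tree by (simp add: tree_poset_def)
  ultimately show ?thesis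
    unfolding uniformly_branching_def using finite_poset_tree by blast
qed

lemma rk_chain_poset: assumes "i < m" shows "rk (chain_poset m) i = i"
proof -
  let ?C = "chain_poset m"
  have under: "under ?C i = {..i}" using assms by (auto simp: under_def chain_poset_def)
  have "i \<in> Field ?C" using assms by (auto simp: Field_def chain_poset_def)
  then obtain D where "D \<subseteq> under ?C i" "card D = rk ?C i + 1"
    by (rule rk_chain[OF finite_poset_chain]) blast
  hence "rk ?C i \<le> i" using card_mono[of "{..i}" D] under by simp
  moreover have "{..i} \<in> Chains ?C" using assms by (auto simp: Chains_def chain_poset_def)
  hence "i \<le> rk ?C i" using rk_ge_chain[OF finite_poset_chain, of "{..i}" m i] under by simp
  ultimately show ?thesis by simp
qed

lemma uniformly_branching_chain: "uniformly_branching (chain_poset (n + 1)) 1 n"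
proof -
  let ?C = "chain_poset (n + 1)"
  have F: "Field ?C = {..n}" by (auto simp: chain_poset_def Field_def)
  have rk: "rk ?C i = i" if "i \<le> n" for i using rk_chain_poset[of i "n + 1"] that by simp
  have "{j. (i, j) \<in> ?C \<and> rk ?C j = rk ?C i + k} = {i + k}"
    if "i \<le> n" "rk ?C i + k \<le> n" for i k
    using that rk by (auto simp: chain_poset_def)
  moreover have "(0, i) \<in> ?C" if "i \<le> n" for i using that by (simp add: chain_poset_def)
  ultimately show ?thesis
    unfolding uniformly_branching_def F using finite_poset_chain rk[of 0] 
    by (auto intro!: bexI[of _ 0])
qed

lemma card_within_distance:
  assumes Q: "uniformly_branching Q t n" and q: "q \<in> Field Q" and d: "rk Q q + d \<le> n"
  shows "int (card {q'. (q, q') \<in> Q \<and> rk Q q' \<le> rk Q q + d}) = q_bracket t (Suc d)"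
  using d
proof (induction d)
  case 0
  have fp: "finite_poset Q" using Q by (simp add: uniformly_branching_def)
  have "{q'. (q, q') \<in> Q \<and> rk Q q' \<le> rk Q q + 0} = {q'. (q, q') \<in> Q \<and> rk Q q' = rk Q q + 0}"
    using rk_mono[OF fp] by fastforce
  moreover have "card {q'. (q, q') \<in> Q \<and> rk Q q' = rk Q q + 0} = t ^ 0"
    using Q q 0 unfolding uniformly_branching_def by blast
  ultimately show ?case by (simp add: q_bracket_def)
next
  case (Suc d)
  let ?A = "{q'. (q, q') \<in> Q \<and> rk Q q' \<le> rk Q q + d}"
  let ?B = "{q'. (q, q') \<in> Q \<and> rk Q q' = rk Q q + Suc d}"
  have "{q'. (q, q') \<in> Q} \<subseteq> Field Q" by (auto simp: Field_def)
  hence "finite {q'. (q, q') \<in> Q}"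
    using Q unfolding uniformly_branching_def finite_poset_def by (meson finite_subset)
  hence "finite ?A" "finite ?B" by auto
  moreover have "?A \<inter> ?B = {}" by auto
  moreover have "{q'. (q, q') \<in> Q \<and> rk Q q' \<le> rk Q q + Suc d} = ?A \<union> ?B" by auto
  moreover have "card ?B = t ^ Suc d"
    using Q q Suc.prems unfolding uniformly_branching_def by blast
  ultimately show ?case using Suc by (simp add: card_Un_disjoint q_bracket_Suc)
qed

text \<open>The elements up to level \<open>d\<close> are the elements within distance \<open>d\<close> of the root.\<close>

lemma card_lower_levels:
  assumes Q: "uniformly_branching Q t n" and d: "d \<le> n"
  shows "int (card {q \<in> Field Q. rk Q q \<le> d}) = q_bracket t (Suc d)"
proof -
  obtain q\<^sub>0 where q\<^sub>0: "q\<^sub>0 \<in> Field Q" "rk Q q\<^sub>0 = 0" "\<forall>q\<in>Field Q. (q\<^sub>0, q) \<in> Q"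
    using Q by (auto simp: uniformly_branching_def)
  hence "{q \<in> Field Q. rk Q q \<le> d} = {q'. (q\<^sub>0, q') \<in> Q \<and> rk Q q' \<le> rk Q q\<^sub>0 + d}"
    by (auto simp: Field_def)
  thus ?thesis using card_within_distance[OF Q q\<^sub>0(1), of d] q\<^sub>0(2) d by simp
qed

section \<open>The Moebius number of a Rees product\<close>

lemma sum_moebius:
  assumes "finite_poset r" "(x, z) \<in> r" "x \<noteq> z"
  shows "(\<Sum>y | (x, y) \<in> r \<and> (y, z) \<in> r. moebius r x y) = 0"
proof -
  let ?A = "{y. (x, y) \<in> r \<and> (y, z) \<in> r}"
  have "finite ?A"
    by (rule finite_subset[of _ "Field r"]) (use assms in \<open>auto simp: finite_poset_def Field_def\<close>)
  moreover have "z \<in> ?A" using assms by (auto simp: finite_poset_alt refl_on_def Field_def)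
  ultimately have "sum (moebius r x) ?A = moebius r x z + sum (moebius r x) (?A - {z})"
    by (rule sum.remove)
  moreover have "?A - {z} = {y. (x, y) \<in> r \<and> (y, z) \<in> r \<and> y \<noteq> z}" by auto
  ultimately show ?thesis using assms moebius.simps[of r x z] by simp
qed

text \<open>
  The witness \<open>f v\<close> is the Moebius function from the adjoined minimum to \<open>v\<close>. That minimum has
  Moebius value \<open>1\<close>, whence the \<open>-1\<close> in the recursion and the \<open>1 +\<close> in the total.
\<close>

lemma moebius_number_adjoin:
  assumes s: "finite_poset s"
  obtains f where "\<And>w. w \<in> Field s \<Longrightarrow> (\<Sum>v\<in>under s w. f v) = -1"
    and "moebius_number (adjoin s) = - (1 + (\<Sum>v\<in>Field s. f v))"
proof -
  let ?A = "adjoin s"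
  define f where "f v = moebius ?A Zero (Elem v)" for v
  have fp: "finite_poset ?A" by (rule finite_poset_adjoin[OF s])
  have zero: "moebius ?A Zero Zero = 1"
    using fp by (subst moebius.simps) (simp add: adjoin_def)
  have inj: "inj_on Elem X" for X :: "'a set" by (simp add: inj_on_def)
  have sum: "(\<Sum>y\<in>insert Zero (Elem ` X). moebius ?A Zero y) = 1 + sum f X" if "finite X" for X
  proof -
    have "Zero \<notin> Elem ` X" by auto
    thus ?thesis using that zero by (simp add: sum.reindex[OF inj] f_def)
  qed
  have "(\<Sum>v\<in>under s w. f v) = -1" if w: "w \<in> Field s" for w
  proof -
    have "{y. (Zero, y) \<in> ?A \<and> (y, Elem w) \<in> ?A} = insert Zero (Elem ` under s w)"
      using w by (auto simp: adjoin_def under_def Field_def)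
    moreover have "(\<Sum>y | (Zero, y) \<in> ?A \<and> (y, Elem w) \<in> ?A. moebius ?A Zero y) = 0"
      by (rule sum_moebius[OF fp]) (use w in \<open>auto simp: adjoin_def\<close>)
    ultimately show ?thesis using sum[OF finite_under[OF s]] by simp
  qed
  moreover have "moebius_number ?A = - (1 + (\<Sum>v\<in>Field s. f v))"
  proof -
    have "{y. (Zero, y) \<in> ?A \<and> (y, One) \<in> ?A \<and> y \<noteq> One} = insert Zero (Elem ` Field s)"
      by (auto simp: adjoin_def)
    moreover have "(Zero, One) \<in> ?A" by (simp add: adjoin_def)
    moreover have "finite (Field s)" using s by (simp add: finite_poset_def)
    ultimately have "moebius ?A Zero One = - (1 + (\<Sum>v\<in>Field s. f v))"
      using fp sum by (subst moebius.simps) simp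
    thus ?thesis
      by (simp add: moebius_number_def poset_bot_def poset_top_def minimal_in_adjoin
          maximal_in_adjoin)
  qed
  ultimately show ?thesis by (rule that)
qed

text \<open>
  The weight \<open>G\<close> collects the Moebius values over each element of \<open>P\<close>, as explained at the beginning.
  For \<open>y\<close> other than the least element \<open>0\<close>, the summed recursion reads
  \<open>(\<Sum>0<x\<le>y. G x * [\<rho> y - \<rho> x + 1]) = - [\<rho> y]\<close>, because there are \<open>[\<rho> y]\<close> pairs \<open>(y, q)\<close>. Setting
  \<open>G 0 = 1\<close> adds \<open>[\<rho> y + 1]\<close> to the left side, and the right side becomes \<open>t ^ \<rho> y\<close>; the same value
  accounts for the minimum of \<open>Rees(P, T)\<close> in the total.
\<close>

lemma moebius_number_rees:
  fixes P :: "'a rel" and Q :: "'b rel"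
  assumes g: "graded P" and rank: "poset_rank P = n + 1" and Q: "uniformly_branching Q t n"
  obtains G where "\<And>y. y \<in> Field P \<Longrightarrow>
      (\<Sum>x\<in>under P y. G x * q_bracket t (Suc (rk P y - rk P x))) = int t ^ rk P y"
    and "moebius_number (rees P Q) = - (\<Sum>x\<in>Field P. G x)"
proof -
  let ?b = "poset_bot P"
  define P' where "P' = Restr P (Field P - {?b})"
  define R where "R = rees_product P' Q"
  have fP: "finite_poset P" using g by (simp add: graded_def)
  have fQ: "finite_poset Q" using Q by (simp add: uniformly_branching_def)
  have fP': "finite_poset P'" unfolding P'_def by (rule finite_poset_Restr[OF fP])
  have fR: "finite_poset R" unfolding R_def by (rule finite_poset_rees_product[OF fP' fQ])
  have FP': "Field P' = Field P - {?b}" unfolding P'_def by (rule Field_delete_bot[OF g])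
  have rkP: "rk P x = rk P' x + 1" if "x \<in> Field P'" for x
    using rk_delete_bot[OF g, of x] that unfolding FP' by (simp add: P'_def)
  have bF: "?b \<in> Field P" and rk_b: "rk P ?b = 0"
    using graded_bot(1)[OF g] rk_minimal[OF fP] by (auto simp: minimal_in_def)
  have rk_le: "rk P' x \<le> n" if "x \<in> Field P'" for x
    using rk_plus_dual_rk[OF g, of x] rank rkP[OF that] that FP' by auto
  \<comment> \<open>\<open>S x\<close> is the fibre of the Rees product over \<open>x\<close>.\<close>
  define S where "S x = {q \<in> Field Q. rk Q q \<le> rk P' x}" for x
  have finS: "finite (S x)" for x using fQ by (simp add: S_def finite_poset_def)
  have FR: "Field R = Sigma (Field P') S"
  proof
    show "Field R \<subseteq> Sigma (Field P') S"
      by (auto simp: R_def rees_product_def S_def Field_def)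
    have "((x, q), (x, q)) \<in> R" if "x \<in> Field P'" "q \<in> S x" for x q
      using that fP' fQ
      by (auto simp: R_def rees_product_def S_def finite_poset_alt refl_on_def)
    thus "Sigma (Field P') S \<subseteq> Field R" by (auto intro: FieldI1)
  qed
  obtain f where f: "\<And>w. w \<in> Field R \<Longrightarrow> (\<Sum>v\<in>under R w. f v) = -1"
    and mu: "moebius_number (adjoin R) = - (1 + (\<Sum>v\<in>Field R. f v))"
    using moebius_number_adjoin[OF fR] by blast
  define F where "F x = (\<Sum>q\<in>S x. f (x, q))" for x
  define G where "G x = (if x = ?b then 1 else F x)" for x
  have finP': "finite (Field P')" using fP' by (simp add: finite_poset_def)
  have finR: "finite (Field R)" using fR by (simp add: finite_poset_def)
  have sumF: "(\<Sum>x\<in>under P' y. F x * q_bracket t (Suc (rk P' y - rk P' x)))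
      = - q_bracket t (Suc (rk P' y))" if y: "y \<in> Field P'" for y
  proof -
    \<comment> \<open>The multiplicity of \<open>(x, q)\<close> in the summed recursion. The bound on ranks in \<open>S y\<close> is implied by
      the rank condition in the order, and \<open>y\<close> has rank at most \<open>n\<close> in \<open>P'\<close>, so the top of \<open>Q\<close> cuts nothing off.\<close>
    have up: "int (card {q' \<in> S y. ((x, q), (y, q')) \<in> R})
        = q_bracket t (Suc (rk P' y - rk P' x))" if x: "(x, y) \<in> P'" and q: "q \<in> S x" for x q
    proof -
      have mono: "rk P' x \<le> rk P' y" by (rule rk_mono[OF fP' x])
      have "q \<in> Field Q" "rk Q q \<le> rk P' x" using q by (auto simp: S_def)
      hence "rk Q q + (rk P' y - rk P' x) \<le> n" using rk_le[OF y] mono by simp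
      moreover have "{q' \<in> S y. ((x, q), (y, q')) \<in> R}
          = {q'. (q, q') \<in> Q \<and> rk Q q' \<le> rk Q q + (rk P' y - rk P' x)}"
        using q x mono by (auto simp: S_def R_def rees_product_def Field_def)
      ultimately show ?thesis using card_within_distance[OF Q \<open>q \<in> Field Q\<close>] by simp
    qed
    have Sig: "Sigma (under P' y) S \<subseteq> Field R" unfolding FR by (auto simp: under_def Field_def)
    have "- q_bracket t (Suc (rk P' y)) = (\<Sum>q'\<in>S y. -1)"
      using card_lower_levels[OF Q rk_le[OF y]] by (simp add: S_def)
    also have "\<dots> = (\<Sum>q'\<in>S y. \<Sum>v\<in>under R (y, q'). f v)"
      by (rule sum.cong) (use f FR y in auto)
    also have "\<dots> = (\<Sum>q'\<in>S y. \<Sum>v | v \<in> Sigma (under P' y) S \<and> (v, (y, q')) \<in> R. f v)"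
      by (intro sum.cong refl) (auto simp: under_def R_def rees_product_def S_def Field_def)
    also have "\<dots> = (\<Sum>v\<in>Sigma (under P' y) S. \<Sum>q' | q' \<in> S y \<and> (v, (y, q')) \<in> R. f v)"
      by (rule sum.swap_restrict) (use finS finite_subset[OF Sig finR] in auto)
    also have "\<dots> = (\<Sum>v\<in>Sigma (under P' y) S.
        f v * q_bracket t (Suc (rk P' y - rk P' (fst v))))"
      by (intro sum.cong refl) (use up in \<open>auto simp: under_def\<close>)
    also have "\<dots> = (\<Sum>x\<in>under P' y. \<Sum>q\<in>S x.
        f (x, q) * q_bracket t (Suc (rk P' y - rk P' x)))"
      by (subst sum.Sigma) (use finite_under[OF fP'] finS in \<open>auto simp: case_prod_beta\<close>)
    also have "\<dots> = (\<Sum>x\<in>under P' y. F x * q_bracket t (Suc (rk P' y - rk P' x)))"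
      by (simp add: F_def sum_distrib_right)
    finally show ?thesis by simp
  qed
  have "(\<Sum>x\<in>under P y. G x * q_bracket t (Suc (rk P y - rk P x))) = int t ^ rk P y"
    if y: "y \<in> Field P" for y
  proof (cases "y = ?b")
    case True
    have "under P ?b = {?b}"
      using graded_bot[OF g] bF by (auto simp: under_def minimal_in_def)
    thus ?thesis using True rk_b by (simp add: G_def q_bracket_def)
  next
    case False
    hence y': "y \<in> Field P'" using y FP' by simp
    have un: "under P y = insert ?b (under P' y)"
      using graded_bot(2)[OF g] y False by (auto simp: under_def P'_def Field_def)
    have nb: "?b \<notin> under P' y" by (auto simp: under_def P'_def)
    have "(\<Sum>x\<in>under P' y. G x * q_bracket t (Suc (rk P y - rk P x)))
        = (\<Sum>x\<in>under P' y. F x * q_bracket t (Suc (rk P' y - rk P' x)))"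
    proof (rule sum.cong)
      fix x assume x: "x \<in> under P' y"
      hence "x \<in> Field P'" by (auto simp: under_def Field_def)
      moreover have "x \<noteq> ?b" using x nb by blast
      ultimately show "G x * q_bracket t (Suc (rk P y - rk P x))
          = F x * q_bracket t (Suc (rk P' y - rk P' x))"
        using rkP y' by (simp add: G_def)
    qed simp
    hence "(\<Sum>x\<in>under P y. G x * q_bracket t (Suc (rk P y - rk P x)))
        = q_bracket t (Suc (rk P y)) - q_bracket t (rk P y)"
      using un nb finite_under[OF fP'] rk_b sumF[OF y'] rkP[OF y'] by (simp add: G_def)
    thus ?thesis by (simp add: q_bracket_Suc)
  qed
  moreover have "moebius_number (rees P Q) = - (\<Sum>x\<in>Field P. G x)"
  proof -
    have "(\<Sum>v\<in>Field R. f v) = (\<Sum>x\<in>Field P'. F x)"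
      unfolding FR F_def by (subst sum.Sigma) (use finP' finS in auto)
    also have "\<dots> = (\<Sum>x\<in>Field P'. G x)"
      by (rule sum.cong) (auto simp: G_def FP')
    finally have "1 + (\<Sum>v\<in>Field R. f v) = (\<Sum>x\<in>Field P. G x)"
      using sum.remove[OF _ bF, of G] fP by (simp add: finite_poset_def FP' G_def)
    thus ?thesis using mu by (simp add: rees_def R_def P'_def)
  qed
  ultimately show ?thesis by (rule that)
qed

section \<open>Duality\<close>

text \<open>
  Both systems of \<open>moebius_number_rees\<close>, for the poset and for its dual, have the same
  kernel \<open>[\<rho> y - \<rho> x + 1]\<close>, one acting from the left and one from the right. Pairing their solutions
  through it expresses the total of either by the same symmetric quantity.
\<close>

lemma moebius_number_rees_dual:
  fixes P :: "'a rel" and Q :: "'b rel"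
  assumes g: "graded P" and rank: "poset_rank P = n + 1" and Q: "uniformly_branching Q t n"
  shows "moebius_number (rees P Q) = moebius_number (rees (P\<inverse>) Q)"
proof -
  let ?N = "n + 1" and ?K = "\<lambda>x y. q_bracket t (Suc (rk P y - rk P x))"
  have fP: "finite_poset P" using g by (simp add: graded_def)
  hence fin: "finite (Field P)" by (simp add: finite_poset_def)
  have g': "graded (P\<inverse>)" by (rule graded_converse[OF g])
  have rk': "rk (P\<inverse>) x = ?N - rk P x" "rk P x \<le> ?N" if "x \<in> Field P" for x
    using rk_plus_dual_rk[OF g that] rank by auto
  have bot: "poset_bot P \<in> Field P" "rk P (poset_bot P) = 0"
    using graded_bot(1)[OF g] rk_minimal[OF fP] by (auto simp: minimal_in_def)
  have top: "poset_top P \<in> Field P" "rk P (poset_top P) = ?N"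
    using graded_top(1)[OF g] rank by (auto simp: maximal_in_def poset_rank_def)
  have "rk (P\<inverse>) (poset_bot P) = ?N" using rk'(1)[OF bot(1)] bot(2) by simp
  hence rank': "poset_rank (P\<inverse>) = n + 1"
    using rk_plus_dual_rk[OF g', of "poset_bot P"] bot by simp
  obtain G where G: "\<And>y. y \<in> Field P \<Longrightarrow> (\<Sum>x\<in>under P y. G x * ?K x y) = int t ^ rk P y"
    and muG: "moebius_number (rees P Q) = - (\<Sum>x\<in>Field P. G x)"
    using moebius_number_rees[OF g rank Q] by blast
  obtain H where H0: "\<And>x. x \<in> Field (P\<inverse>) \<Longrightarrow> (\<Sum>y\<in>under (P\<inverse>) x.
        H y * q_bracket t (Suc (rk (P\<inverse>) x - rk (P\<inverse>) y))) = int t ^ rk (P\<inverse>) x"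
    and muH: "moebius_number (rees (P\<inverse>) Q) = - (\<Sum>x\<in>Field (P\<inverse>). H x)"
    using moebius_number_rees[OF g' rank' Q] by blast
  have H: "(\<Sum>y | (x, y) \<in> P. H y * ?K x y) = int t ^ (?N - rk P x)" if x: "x \<in> Field P" for x
  proof -
    have "(\<Sum>y | (x, y) \<in> P. H y * ?K x y)
        = (\<Sum>y\<in>under (P\<inverse>) x. H y * q_bracket t (Suc (rk (P\<inverse>) x - rk (P\<inverse>) y)))"
    proof (rule sum.cong)
      fix y assume "y \<in> under (P\<inverse>) x"
      hence "(x, y) \<in> P" "y \<in> Field P" by (auto simp: under_def Field_def)
      thus "H y * ?K x y = H y * q_bracket t (Suc (rk (P\<inverse>) x - rk (P\<inverse>) y))"
        using rk'[OF x] rk'[of y] by simp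
    qed (simp add: under_def)
    thus ?thesis using H0[of x] x rk' by simp
  qed
  \<comment> \<open>Used with \<open>c = G x\<close>, \<open>d = N - \<rho> x\<close> and with \<open>c = H y\<close>, \<open>d = \<rho> y\<close>.\<close>
  have split: "c = (1 - int t) * (c * q_bracket t (Suc d)) + int t * (c * int t ^ d)" for c d
  proof -
    have "c = c * ((1 - int t) * q_bracket t (Suc d) + int t * int t ^ d)"
      unfolding q_bracket_Suc_identity by simp
    thus ?thesis by (simp add: algebra_simps)
  qed
  define D where "D = (\<Sum>x\<in>Field P. \<Sum>y | y \<in> Field P \<and> (x, y) \<in> P. G x * ?K x y * H y)"
  have D1: "D = (\<Sum>x\<in>Field P. G x * int t ^ (?N - rk P x))"
    unfolding D_def
  proof (rule sum.cong)
    fix x assume x: "x \<in> Field P"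
    have "{y. y \<in> Field P \<and> (x, y) \<in> P} = {y. (x, y) \<in> P}" by (auto simp: Field_def)
    hence "(\<Sum>y | y \<in> Field P \<and> (x, y) \<in> P. G x * ?K x y * H y)
        = G x * (\<Sum>y | (x, y) \<in> P. H y * ?K x y)"
      by (simp add: sum_distrib_left mult_ac)
    thus "(\<Sum>y | y \<in> Field P \<and> (x, y) \<in> P. G x * ?K x y * H y) = G x * int t ^ (?N - rk P x)"
      using H[OF x] by simp
  qed simp
  have "D = (\<Sum>y\<in>Field P. \<Sum>x | x \<in> Field P \<and> (x, y) \<in> P. G x * ?K x y * H y)"
    unfolding D_def by (rule sum.swap_restrict[OF fin fin])
  also have "\<dots> = (\<Sum>y\<in>Field P. H y * int t ^ rk P y)"
  proof (rule sum.cong)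
    fix y assume y: "y \<in> Field P"
    have "{x. x \<in> Field P \<and> (x, y) \<in> P} = under P y" by (auto simp: Field_def under_def)
    hence "(\<Sum>x | x \<in> Field P \<and> (x, y) \<in> P. G x * ?K x y * H y)
        = H y * (\<Sum>x\<in>under P y. G x * ?K x y)"
      by (simp add: sum_distrib_left mult_ac)
    thus "(\<Sum>x | x \<in> Field P \<and> (x, y) \<in> P. G x * ?K x y * H y) = H y * int t ^ rk P y"
      using G[OF y] by simp
  qed simp
  finally have D2: "D = (\<Sum>y\<in>Field P. H y * int t ^ rk P y)" .
  have under_top: "under P (poset_top P) = Field P"
    using graded_top(2)[OF g] by (auto simp: under_def Field_def)
  have above_bot: "{y. (poset_bot P, y) \<in> P} = Field P"
    using graded_bot(2)[OF g] by (auto simp: Field_def)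
  have "(\<Sum>x\<in>Field P. G x)
      = (1 - int t) * (\<Sum>x\<in>Field P. G x * q_bracket t (Suc (?N - rk P x))) + int t * D"
    unfolding D1 sum_distrib_left sum.distrib[symmetric] by (rule sum.cong[OF refl split])
  also have "(\<Sum>x\<in>Field P. G x * q_bracket t (Suc (?N - rk P x))) = int t ^ ?N"
    using G[OF top(1)] unfolding under_top top(2) .
  also have "int t ^ ?N = (\<Sum>y\<in>Field P. H y * q_bracket t (Suc (rk P y)))"
    using H[OF bot(1)] unfolding above_bot bot(2) by simp
  also have "(1 - int t) * \<dots> + int t * D = (\<Sum>y\<in>Field P. H y)"
    unfolding D2 sum_distrib_left sum.distrib[symmetric]
    by (rule sum.cong[OF refl split[symmetric]])
  finally show ?thesis using muG muH by simp
qed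

theorem theorem2p4:
  fixes n t :: nat and P :: "'a rel"
  assumes "graded P" and "poset_rank P = n + 1"
  shows "moebius_number (rees P (tree_poset t (n + 1)))
           = moebius_number (rees (P\<inverse>) (tree_poset t (n + 1)))
       \<and> moebius_number (rees P (chain_poset (n + 1)))
           = moebius_number (rees (P\<inverse>) (chain_poset (n + 1)))"
  using moebius_number_rees_dual[OF assms uniformly_branching_tree]
    moebius_number_rees_dual[OF assms uniformly_branching_chain] by blast

end
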